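(* Let $\mathcal D$ be the Lie algebra of differential operators on $\mathbb C[t,t^{-1}]$, with basis $\{t^mD^n\mid m\in\mathbb Z,\ n\in\mathbb N\}$. Let $M$ be a $\mathcal D$-module whose restriction to $U(\mathbb C D)=\mathbb C[D]$ is free of rank $1$. Then $M\cong\Omega(\lambda,\epsilon)$ as $\mathcal D$-modules for some $\lambda\in\mathbb C^*$ and some $\epsilon\in\{0,1\}$.
   Context: All algebras and modules are over $\mathbb C$; $\mathbb N$ denotes the non-negative integers and $\mathbb C^*=\mathbb C\setminus\{0\}$. $\mathcal D_{ass}$ is the associative algebra of all differential operators on $\mathbb C[t,t^{-1}]$. With $D=t\frac{d}{dt}$ it has basis $\{t^mD^n\mid m\in\mathbb Z,n\in\mathbb N\}$ and multiplication $$(t^{m_1}D^{n_1})(t^{m_2}D^{n_2})=\sum_{i=0}^{n_1}\binom{n_1}{i}m_2^i\,t^{m_1+m_2}D^{n_1+n_2-i}$$ (with $0^0=1$). $\mathcal D$ is the Lie algebra with the same underlying space and the commutator bracket $[a,b]=ab-ba$. $U(\mathbb CD)$ is the universal enveloping algebra of the one-dimensional Lie subalgebra $\mathbb CD\subset\mathcal D$; it acts on $M$ through the action of the Lie algebra element $D=t^0D^1$. (In $U(\mathcal D)$, the power of the element $D$ is not the same as the Lie algebra element $D^n=t^0D^n\in\mathcal D$ for $n\neq 1$.) For $\lambda\in\mathbb C^*$ and $\epsilon\in\{0,1\}$, $\Omega(\lambda,\epsilon)$ is the $\mathcal D$-module with underlying space the polynomial algebra $\mathbb C[x]$ and action $$t^mD^n\cdot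 f(x)=\beta^{1-n}\lambda^m(x-\epsilon m)^nf(x-m),\qquad \beta=(-1)^{1-\epsilon},$$ for $f(x)\in\mathbb C[x]$, $m\in\mathbb Z$, $n\in\mathbb N$. *)

theory Defs
  imports Complex_Main "HOL-Library.Poly_Mapping" "HOL-Computational_Algebra.Polynomial"
begin

section \<open>Lie algebras, Lie modules and free modules\<close>

locale lie_algebra = vector_space scale
  for scale :: "'k::field \<Rightarrow> 'g::ab_group_add \<Rightarrow> 'g" +
  fixes bracket :: "'g \<Rightarrow> 'g \<Rightarrow> 'g"
  assumes linear_bracket_right: "Vector_Spaces.linear scale scale (\<lambda>b. bracket a b)"
    and linear_bracket_left: "Vector_Spaces.linear scale scale (\<lambda>a. bracket a b)"
    and bracket_self: "bracket a a = 0"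
    and jacobi: "bracket a (bracket b c) + bracket b (bracket c a) + bracket c (bracket a b) = 0"

locale lie_module = A: lie_algebra scaleA bracket + M: vector_space scaleM
  for scaleA :: "'k::field \<Rightarrow> 'g::ab_group_add \<Rightarrow> 'g"
    and bracket :: "'g \<Rightarrow> 'g \<Rightarrow> 'g"
    and scaleM :: "'k \<Rightarrow> 'm::ab_group_add \<Rightarrow> 'm" +
  fixes act :: "'g \<Rightarrow> 'm \<Rightarrow> 'm"
  assumes linear_act: "Vector_Spaces.linear scaleM scaleM (\<lambda>v. act a v)"
    and linear_act_left: "Vector_Spaces.linear scaleA scaleM (\<lambda>a. act a v)"
    and act_bracket: "act (bracket a b) v = act a (act b v) - act b (act a v)"

definition lie_modules_isomorphic ::
  "('k::field \<Rightarrow> 'm::ab_group_add \<Rightarrow> 'm) \<Rightarrow> ('g \<Rightarrow> 'm \<Rightarrow> 'm) \<Rightarrow>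
   ('k \<Rightarrow> 'n::ab_group_add \<Rightarrow> 'n) \<Rightarrow> ('g \<Rightarrow> 'n \<Rightarrow> 'n) \<Rightarrow> bool" where
  "lie_modules_isomorphic scaleM actM scaleN actN \<longleftrightarrow>
     (\<exists>\<phi>. Vector_Spaces.linear scaleM scaleN \<phi> \<and> bij \<phi> \<and>
          (\<forall>a v. \<phi> (actM a v) = actN a (\<phi> v)))"

definition free_of_rank :: "('r::comm_ring_1 \<Rightarrow> 'm::ab_group_add \<Rightarrow> 'm) \<Rightarrow> nat \<Rightarrow> bool" where
  "free_of_rank scale r \<longleftrightarrow> module scale \<and>
     (\<exists>B. finite B \<and> card B = r \<and> \<not> module.dependent scale B \<and> module.span scale B = UNIV)"

text \<open>
  The module structure over the polynomial ring \<open>k[X]\<close> in which \<open>X\<close> acts by the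
  endomorphism \<open>T\<close>. The enveloping algebra of the one-dimensional Lie algebra \<open>\<complex>D\<close> is the
  polynomial ring \<open>\<complex>[D]\<close>, so restricting a \<open>\<D>\<close>-module to it gives this structure with \<open>T\<close> the
  action of \<open>D = t\<^sup>0 D\<^sup>1\<close>. Powers of \<open>D\<close> are iterates of \<open>T\<close>, not the actions of the
  elements \<open>t\<^sup>0 D\<^sup>n\<close> of \<open>\<D>\<close>.
\<close>

definition poly_action :: "('k::field \<Rightarrow> 'm::ab_group_add \<Rightarrow> 'm) \<Rightarrow> ('m \<Rightarrow> 'm) \<Rightarrow> 'k poly \<Rightarrow> 'm \<Rightarrow> 'm"
  where "poly_action scale T p v = (\<Sum>i\<le>degree p. scale (coeff p i) ((T ^^ i) v))"

context vector_space
begin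

lemma poly_action_upto:
  assumes "degree p \<le> N"
  shows "poly_action scale T p v = (\<Sum>i\<le>N. scale (coeff p i) ((T ^^ i) v))"
  unfolding poly_action_def
  by (rule sum.mono_neutral_left) (use assms in \<open>auto simp: coeff_eq_0\<close>)

lemma poly_action_0: "poly_action scale T 0 v = 0"
  by (simp add: poly_action_def)

lemma poly_action_add: "poly_action scale T (p + q) v = poly_action scale T p v + poly_action scale T q v"
proof -
  let ?N = "max (degree p) (degree q)"
  show ?thesis
    by (simp add: poly_action_upto[of _ ?N] degree_add_le scale_left_distrib sum.distrib)
qed

lemma poly_action_smult: "poly_action scale T (smult c p) v = scale c (poly_action scale T p v)"
  by (simp add: poly_action_upto[of _ "degree p"] degree_smult_le scale_sum_right)

lemma module_poly_action:
  assumes "Vector_Spaces.linear scale scale T"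
  shows "module (poly_action scale T)"
proof -
  interpret T: Vector_Spaces.linear scale scale T by fact
  have lin: "(T ^^ i) (v + w) = (T ^^ i) v + (T ^^ i) w"
    "(T ^^ i) (scale c v) = scale c ((T ^^ i) v)" for i v w c
    by (induction i) (simp_all add: T.add T.scale)
  have radd: "poly_action scale T p (v + w) = poly_action scale T p v + poly_action scale T p w" for p v w
    by (simp add: poly_action_def lin scale_right_distrib sum.distrib)
  have pC: "poly_action scale T (pCons a p) v = scale a v + T (poly_action scale T p v)" for a p v
  proof -
    have "poly_action scale T (pCons a p) v = (\<Sum>i\<le>Suc (degree p). scale (coeff (pCons a p) i) ((T ^^ i) v))"
      by (rule poly_action_upto) (simp add: degree_pCons_le)
    also have "\<dots> = scale a v + (\<Sum>i\<le>degree p. scale (coeff p i) ((T ^^ Suc i) v))"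
      by (subst sum.atMost_Suc_shift) simp
    finally show ?thesis by (simp add: poly_action_def T.sum T.scale)
  qed
  have mult: "poly_action scale T (p * q) v = poly_action scale T p (poly_action scale T q v)" for p q v
    by (induction p) (simp_all add: poly_action_0 poly_action_add poly_action_smult pC)
  show ?thesis
    by unfold_locales (simp_all add: radd poly_action_add mult, simp add: one_pCons pC poly_action_0)
qed

end


section \<open>The algebra of differential operators on \<open>\<complex>[t, t\<^sup>-\<^sup>1]\<close>\<close>

text \<open>
  The basis element \<open>t\<^sup>m D\<^sup>n\<close> is the index \<open>(m, n)\<close>. The multiplication which \<^theory>\<open>HOL-Library.Poly_Mapping\<close>
  puts on this type is the commutative convolution product; it is not used.
\<close>

type_synonym diffop = "(int \<times> nat) \<Rightarrow>\<^sub>0 complex"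

definition tD :: "int \<Rightarrow> nat \<Rightarrow> diffop" where
  "tD m n = Poly_Mapping.single (m, n) 1"

definition diffop_scale :: "complex \<Rightarrow> diffop \<Rightarrow> diffop" where
  "diffop_scale c a = Poly_Mapping.map ((*) c) a"

fun tD_mult :: "int \<times> nat \<Rightarrow> int \<times> nat \<Rightarrow> diffop" where
  "tD_mult (m1, n1) (m2, n2) =
     (\<Sum>i\<le>n1. diffop_scale (of_nat (n1 choose i) * of_int m2 ^ i) (tD (m1 + m2) (n1 + n2 - i)))"

definition diffop_mult :: "diffop \<Rightarrow> diffop \<Rightarrow> diffop" where
  "diffop_mult a b =
     (\<Sum>k\<in>Poly_Mapping.keys a. \<Sum>l\<in>Poly_Mapping.keys b.
       diffop_scale (Poly_Mapping.lookup a k * Poly_Mapping.lookup b l) (tD_mult k l))"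

definition diffop_bracket :: "diffop \<Rightarrow> diffop \<Rightarrow> diffop" where
  "diffop_bracket a b = diffop_mult a b - diffop_mult b a"


section \<open>The modules \<open>\<Omega>(\<lambda>, \<epsilon>)\<close>\<close>

text \<open>
  The parameters are meant to satisfy \<open>\<lambda> \<noteq> 0\<close> and \<open>\<epsilon> \<in> {0, 1}\<close>. Here \<open>[:a, 1:]\<close> is \<open>x + a\<close>, and
  \<open>pcompose f [:a, 1:]\<close> is \<open>f(x + a)\<close>.
\<close>

fun Omega_tD :: "complex \<Rightarrow> nat \<Rightarrow> int \<times> nat \<Rightarrow> complex poly \<Rightarrow> complex poly" where
  "Omega_tD lam \<epsilon> (m, n) f =
     (let \<beta> = (-1) powi (1 - int \<epsilon>) in
      smult (\<beta> powi (1 - int n) * lam powi m)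
        ([:- (of_nat \<epsilon> * of_int m), 1:] ^ n * pcompose f [:- of_int m, 1:]))"

definition Omega_act :: "complex \<Rightarrow> nat \<Rightarrow> diffop \<Rightarrow> complex poly \<Rightarrow> complex poly" where
  "Omega_act lam \<epsilon> a f =
     (\<Sum>k\<in>Poly_Mapping.keys a. smult (Poly_Mapping.lookup a k) (Omega_tD lam \<epsilon> k f))"


section \<open>\<open>\<D>\<close> is a Lie algebra and \<open>\<Omega>(\<lambda>, \<epsilon>)\<close> is a module over it\<close>

lemma lookup_diffop_scale [simp]: "Poly_Mapping.lookup (diffop_scale c a) k = c * Poly_Mapping.lookup a k"
  by (simp add: diffop_scale_def Poly_Mapping.map.rep_eq when_def)

lemma vector_space_diffop: "vector_space diffop_scale"
  by unfold_locales (auto intro!: poly_mapping_eqI simp: lookup_add algebra_simps)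

lemma vector_space_smult: "vector_space (smult :: 'k::field \<Rightarrow> 'k poly \<Rightarrow> 'k poly)"
  by unfold_locales (simp_all add: smult_add_right smult_add_left)

interpretation dv: vector_space diffop_scale by (rule vector_space_diffop)
interpretation pv: vector_space "smult :: 'k::field \<Rightarrow> 'k poly \<Rightarrow> 'k poly" by (rule vector_space_smult)

context vector_space
begin

lemma linear_extension:
  fixes F :: "'i \<Rightarrow> 'b"
  shows "(\<Sum>k\<in>Poly_Mapping.keys (a + b). scale (Poly_Mapping.lookup (a + b) k) (F k)) =
      (\<Sum>k\<in>Poly_Mapping.keys a. scale (Poly_Mapping.lookup a k) (F k)) + (\<Sum>k\<in>Poly_Mapping.keys b. scale (Poly_Mapping.lookup b k) (F k))" (is ?add)
    and "(\<Sum>k\<in>Poly_Mapping.keys (Poly_Mapping.map ((*) c) a). scale (Poly_Mapping.lookup (Poly_Mapping.map ((*) c) a) k) (F k)) =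
      scale c (\<Sum>k\<in>Poly_Mapping.keys a. scale (Poly_Mapping.lookup a k) (F k))" (is ?scale)
proof -
  have ext: "(\<Sum>k\<in>Poly_Mapping.keys d. scale (Poly_Mapping.lookup d k) (F k)) = (\<Sum>k\<in>K. scale (Poly_Mapping.lookup d k) (F k))"
    if "finite K" "Poly_Mapping.keys d \<subseteq> K" for d K
    by (rule sum.mono_neutral_left) (use that in \<open>auto simp: in_keys_iff\<close>)
  let ?K = "Poly_Mapping.keys a \<union> Poly_Mapping.keys b"
  have "Poly_Mapping.keys (a + b) \<subseteq> ?K" by (rule Poly_Mapping.keys_add)
  then have "(\<Sum>k\<in>Poly_Mapping.keys (a + b). scale (Poly_Mapping.lookup (a + b) k) (F k)) =
      (\<Sum>k\<in>?K. scale (Poly_Mapping.lookup (a + b) k) (F k))"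
    by (intro ext) simp_all
  also have "\<dots> = (\<Sum>k\<in>?K. scale (Poly_Mapping.lookup a k) (F k)) +
      (\<Sum>k\<in>?K. scale (Poly_Mapping.lookup b k) (F k))"
    by (simp add: lookup_add scale_left_distrib sum.distrib)
  finally show ?add
    by (simp add: ext[of ?K a] ext[of ?K b])
  have lk: "Poly_Mapping.lookup (Poly_Mapping.map ((*) c) a) k = c * Poly_Mapping.lookup a k" for k
    by (simp add: Poly_Mapping.map.rep_eq when_def)
  have "Poly_Mapping.keys (Poly_Mapping.map ((*) c) a) \<subseteq> Poly_Mapping.keys a"
    by (auto simp: in_keys_iff lk)
  then show ?scale
    by (subst ext[of "Poly_Mapping.keys a"]) (simp_all add: lk scale_sum_right)
qed

end

lemma diffop_mult_alt:
  "diffop_mult a b = (\<Sum>k\<in>Poly_Mapping.keys a. diffop_scale (Poly_Mapping.lookup a k)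
      (\<Sum>l\<in>Poly_Mapping.keys b. diffop_scale (Poly_Mapping.lookup b l) (tD_mult k l)))"
  by (simp add: diffop_mult_def dv.scale_sum_right)

lemma diffop_mult_alt':
  "diffop_mult a b = (\<Sum>l\<in>Poly_Mapping.keys b. diffop_scale (Poly_Mapping.lookup b l)
      (\<Sum>k\<in>Poly_Mapping.keys a. diffop_scale (Poly_Mapping.lookup a k) (tD_mult k l)))"
  unfolding diffop_mult_def dv.scale_sum_right
  by (subst sum.swap) (simp add: mult.commute)

lemma linear_extension_scale:
  "(\<Sum>k\<in>Poly_Mapping.keys (diffop_scale c a). diffop_scale (Poly_Mapping.lookup (diffop_scale c a) k) (F k)) =
     diffop_scale c (\<Sum>k\<in>Poly_Mapping.keys a. diffop_scale (Poly_Mapping.lookup a k) (F k))"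
  "(\<Sum>k\<in>Poly_Mapping.keys (diffop_scale c a). smult (Poly_Mapping.lookup (diffop_scale c a) k) (G k)) =
     smult c (\<Sum>k\<in>Poly_Mapping.keys a. smult (Poly_Mapping.lookup a k) (G k))"
  unfolding diffop_scale_def[of c a]
  by (rule dv.linear_extension pv.linear_extension)+

lemma diffop_mult_bilinear:
  "diffop_mult (a + b) c = diffop_mult a c + diffop_mult b c"
  "diffop_mult a (b + c) = diffop_mult a b + diffop_mult a c"
  "diffop_mult (diffop_scale r a) c = diffop_scale r (diffop_mult a c)"
  "diffop_mult a (diffop_scale r c) = diffop_scale r (diffop_mult a c)"
  subgoal by (simp only: diffop_mult_alt dv.linear_extension)
  subgoal by (simp only: diffop_mult_alt' dv.linear_extension)
  subgoal by (simp only: diffop_mult_alt linear_extension_scale)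
  subgoal by (simp only: diffop_mult_alt' linear_extension_scale)
  done

lemma diffop_mult_tD: "diffop_mult (tD m1 n1) (tD m2 n2) = tD_mult (m1, n1) (m2, n2)"
  by (simp add: diffop_mult_def tD_def del: tD_mult.simps)

lemma Omega_act_tD: "Omega_act lam \<epsilon> (tD m n) f = Omega_tD lam \<epsilon> (m, n) f"
  by (simp add: Omega_act_def tD_def del: Omega_tD.simps)

lemma Omega_act_left:
  "Omega_act lam \<epsilon> (a + b) f = Omega_act lam \<epsilon> a f + Omega_act lam \<epsilon> b f"
  "Omega_act lam \<epsilon> (diffop_scale c a) f = smult c (Omega_act lam \<epsilon> a f)"
  by (simp_all add: Omega_act_def pv.linear_extension linear_extension_scale del: lookup_diffop_scale)

lemma Omega_act_right:
  "Omega_act lam \<epsilon> a (f + g) = Omega_act lam \<epsilon> a f + Omega_act lam \<epsilon> a g"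
  "Omega_act lam \<epsilon> a (smult c f) = smult c (Omega_act lam \<epsilon> a f)"
proof -
  have "Omega_tD lam \<epsilon> k (f + g) = Omega_tD lam \<epsilon> k f + Omega_tD lam \<epsilon> k g"
    "Omega_tD lam \<epsilon> k (smult c f) = smult c (Omega_tD lam \<epsilon> k f)" for k
    by (cases k; simp add: Let_def pcompose_add pcompose_smult algebra_simps smult_add_right)+
  then show "Omega_act lam \<epsilon> a (f + g) = Omega_act lam \<epsilon> a f + Omega_act lam \<epsilon> a g"
    "Omega_act lam \<epsilon> a (smult c f) = smult c (Omega_act lam \<epsilon> a f)"
    by (simp_all add: Omega_act_def smult_add_right sum.distrib pv.scale_sum_right mult.commute
        del: Omega_tD.simps)
qed

lemma diffop_induct [case_names add scale tD]:
  assumes add: "\<And>a b. P a \<Longrightarrow> P b \<Longrightarrow> P (a + b)"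
    and scale: "\<And>c a. P a \<Longrightarrow> P (diffop_scale c a)"
    and tD: "\<And>m n. P (tD m n)"
  shows "P a"
proof -
  have z: "P 0"
    using scale[OF tD, of 0 0 0] by simp
  have a: "a = (\<Sum>(m, n)\<in>Poly_Mapping.keys a. diffop_scale (Poly_Mapping.lookup a (m, n)) (tD m n))"
  proof (rule poly_mapping_eqI)
    fix k
    have "Poly_Mapping.lookup (\<Sum>(m, n)\<in>Poly_Mapping.keys a. diffop_scale (Poly_Mapping.lookup a (m, n)) (tD m n)) k =
        (\<Sum>l\<in>Poly_Mapping.keys a. if l = k then Poly_Mapping.lookup a k else 0)"
      unfolding lookup_sum by (rule sum.cong) (auto simp: tD_def lookup_single when_def)
    then show "Poly_Mapping.lookup a k =
        Poly_Mapping.lookup (\<Sum>(m, n)\<in>Poly_Mapping.keys a. diffop_scale (Poly_Mapping.lookup a (m, n)) (tD m n)) k"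
      by (simp add: in_keys_iff)
  qed
  have "P (\<Sum>(m, n)\<in>K. diffop_scale (Poly_Mapping.lookup a (m, n)) (tD m n))" if "finite K" for K
    using that by induction (auto intro: z add scale tD)
  then show ?thesis by (subst a) simp
qed

text \<open>\<open>tp m p\<close> is \<open>t\<^sup>m p(D)\<close>.\<close>

definition tp :: "int \<Rightarrow> complex poly \<Rightarrow> diffop" where
  "tp m p = (\<Sum>i\<le>degree p. diffop_scale (coeff p i) (tD m i))"

lemma lookup_tp: "Poly_Mapping.lookup (tp m p) (k, i) = (if k = m then coeff p i else 0)"
proof -
  have "Poly_Mapping.lookup (tp m p) (k, i) = (\<Sum>j\<le>degree p. if j = i then (if k = m then coeff p i else 0) else 0)"
    unfolding tp_def lookup_sum
    by (rule sum.cong) (auto simp: tD_def lookup_single when_def)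
  then show ?thesis by (auto simp: coeff_eq_0)
qed

lemma tp_add: "tp m (p + q) = tp m p + tp m q"
  and tp_smult: "tp m (smult c p) = diffop_scale c (tp m p)"
  and tp_monom: "tp m (monom 1 n) = tD m n"
  by (rule poly_mapping_eqI; auto simp: lookup_tp lookup_add tD_def lookup_single when_def coeff_monom split: if_splits)+

lemma tp_sum: "tp m (sum f A) = (\<Sum>i\<in>A. tp m (f i))"
  by (rule poly_mapping_eqI) (auto simp: lookup_tp lookup_sum coeff_sum)

lemma poly_linear_induct [case_names add smult monom]:
  assumes add: "\<And>a b. P a \<Longrightarrow> P b \<Longrightarrow> P (a + b)"
    and smult: "\<And>c a. P a \<Longrightarrow> P (smult c a)"
    and monom: "\<And>n. P (monom 1 n)"
  shows "P (a :: 'k::field poly)"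
proof -
  have z: "P 0"
    using smult[OF monom, of 0 0] by simp
  have m: "P (monom c n)" for c n
    using smult[OF monom, of c n] by (simp add: smult_monom)
  have "P (\<Sum>i\<le>n. monom (coeff a i) i)" for n
    by (induction n) (auto intro: z add m)
  then show ?thesis by (metis poly_as_sum_of_monoms)
qed

lemma tD_mult_tp: "tD_mult (m1, n1) (m2, n2) = tp (m1 + m2) ([:of_int m2, 1:] ^ n1 * monom 1 n2)"
proof -
  have "[:of_int m2, 1:] ^ n1 = ([:of_int m2:] + monom (1::complex) 1) ^ n1"
    by (simp add: monom_altdef)
  also have "\<dots> = (\<Sum>i\<le>n1. of_nat (n1 choose i) * [:of_int m2:] ^ i * monom 1 1 ^ (n1 - i))"
    by (rule binomial_ring)
  also have "\<dots> = (\<Sum>i\<le>n1. smult (of_nat (n1 choose i) * of_int m2 ^ i) (monom 1 (n1 - i)))"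
    by (simp add: monom_power poly_const_pow of_nat_poly mult.commute)
  finally have "[:of_int m2, 1:] ^ n1 * monom 1 n2 =
      (\<Sum>i\<le>n1. smult (of_nat (n1 choose i) * of_int m2 ^ i) (monom (1::complex) (n1 + n2 - i)))"
    by (simp add: sum_distrib_right mult_monom)
  then show ?thesis
    by (simp add: tp_sum tp_smult tp_monom)
qed

lemma diffop_mult_tp: "diffop_mult (tp m p) (tp n q) = tp (m + n) (pcompose p [:of_int n, 1:] * q)"
proof (induction p rule: poly_linear_induct)
  case (monom k)
  show ?case
  proof (induction q rule: poly_linear_induct)
    case (monom l)
    have "pcompose (monom 1 k) [:of_int n, 1:] = [:of_int n, 1::complex:] ^ k"
      by (induction k) (simp_all add: monom_0 monom_Suc pcompose_pCons)
    then show ?case by (simp only: tp_monom diffop_mult_tD tD_mult_tp)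
  qed (simp_all add: diffop_mult_bilinear tp_add tp_smult distrib_left)
qed (simp_all add: diffop_mult_bilinear tp_add tp_smult pcompose_add pcompose_smult distrib_right)

lemma pcompose_shift:
  "pcompose (pcompose p [:a, 1:]) [:b, 1:] = pcompose p [:a + b, 1::'a::comm_ring_1:]"
  by (simp add: pcompose_pCons flip: pcompose_assoc)

lemma diffop_mult_assoc: "diffop_mult (diffop_mult a b) c = diffop_mult a (diffop_mult b c)"
proof (induction a rule: diffop_induct)
  case (tD m1 n1)
  show ?case
  proof (induction b rule: diffop_induct)
    case (tD m2 n2)
    show ?case
    proof (induction c rule: diffop_induct)
      case (tD m3 n3)
      show ?case
        by (simp add: diffop_mult_tp pcompose_mult pcompose_shift add.assoc add.commute[of "of_int m2"]
            mult.assoc flip: tp_monom)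
    qed (simp_all add: diffop_mult_bilinear)
  qed (simp_all add: diffop_mult_bilinear)
qed (simp_all add: diffop_mult_bilinear)

lemma linearI:
  assumes "vector_space s1" "vector_space s2"
    and "\<And>a b. f (a + b) = f a + f b" "\<And>c a. f (s1 c a) = s2 c (f a)"
  shows "Vector_Spaces.linear s1 s2 f"
  using assms by (auto intro!: Vector_Spaces.linear.intro module_hom.intro module_hom_axioms.intro
      simp: module_iff_vector_space)

lemma diffop_mult_diff:
  "diffop_mult (a - b) c = diffop_mult a c - diffop_mult b c"
  "diffop_mult a (b - c) = diffop_mult a b - diffop_mult a c"
  using diffop_mult_bilinear(1)[of "a - b" b c] diffop_mult_bilinear(2)[of a "b - c" c] by simp_all

lemma lie_algebra_diffop: "lie_algebra diffop_scale diffop_bracket"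
proof (intro lie_algebra.intro lie_algebra_axioms.intro vector_space_diffop)
  fix a b c
  show "Vector_Spaces.linear diffop_scale diffop_scale (\<lambda>b. diffop_bracket a b)"
    and "Vector_Spaces.linear diffop_scale diffop_scale (\<lambda>a. diffop_bracket a b)"
    by (auto intro!: linearI vector_space_diffop
        simp: diffop_bracket_def diffop_mult_bilinear dv.scale_right_diff_distrib)
  show "diffop_bracket a a = 0" by (simp add: diffop_bracket_def)
  show "diffop_bracket a (diffop_bracket b c) + diffop_bracket b (diffop_bracket c a)
      + diffop_bracket c (diffop_bracket a b) = 0"
    by (simp add: diffop_bracket_def diffop_mult_diff diffop_mult_assoc)
qed

lemma Omega_act_1_tp:
  assumes "lam \<noteq> 0"
  shows "Omega_act lam 1 (tp m p) f = smult (lam powi m) (pcompose (p * f) [:- of_int m, 1:])"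
proof (induction p rule: poly_linear_induct)
  case (monom n)
  have "pcompose (monom 1 n) [:- of_int m, 1:] = [:- of_int m, 1::complex:] ^ n"
    by (induction n) (simp_all add: monom_0 monom_Suc pcompose_pCons)
  then show ?case by (simp add: tp_monom Omega_act_tD pcompose_mult)
qed (simp_all add: tp_add tp_smult Omega_act_left pcompose_add pcompose_smult algebra_simps smult_add_right)

lemma Omega_act_0_tp:
  assumes "lam \<noteq> 0"
  shows "Omega_act lam 0 (tp m p) f =
    smult (- (lam powi m)) (pcompose p [:0, -1:] * pcompose f [:- of_int m, 1:])"
proof (induction p rule: poly_linear_induct)
  case (monom n)
  have "pcompose (monom 1 n) [:0, -1:] = smult ((-1) ^ n) ([:0, 1::complex:] ^ n)"
    by (induction n) (simp_all add: monom_0 monom_Suc pcompose_pCons)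
  moreover have "(-1) powi (1 - int n) = - ((-1::complex) ^ n)"
    by (simp add: power_int_diff field_simps flip: power_mult_distrib)
  ultimately show ?case by (simp add: tp_monom Omega_act_tD)
qed (simp_all add: tp_add tp_smult Omega_act_left pcompose_add pcompose_smult algebra_simps smult_add_right)

lemma Omega_act_diff: "Omega_act lam \<epsilon> (a - b) f = Omega_act lam \<epsilon> a f - Omega_act lam \<epsilon> b f"
  using Omega_act_left(1)[of lam \<epsilon> "a - b" b f] by simp

lemma Omega_act_bracket_tD:
  assumes "lam \<noteq> 0" "\<epsilon> \<in> {0, 1}"
  shows "Omega_act lam \<epsilon> (diffop_bracket (tp m p) (tp n q)) f =
    Omega_act lam \<epsilon> (tp m p) (Omega_act lam \<epsilon> (tp n q) f) -
    Omega_act lam \<epsilon> (tp n q) (Omega_act lam \<epsilon> (tp m p) f)"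
proof -
  have reflect: "pcompose (pcompose p [:of_int n, 1:]) [:0, -1:] =
      pcompose (pcompose p [:0, -1:]) [:- of_int n, 1::complex:]" for p n
    by (simp add: pcompose_pCons flip: pcompose_assoc)
  from assms consider "\<epsilon> = 0" | "\<epsilon> = 1" by auto
  then show ?thesis
  proof cases
    case 1
    then show ?thesis using assms
      by (simp add: diffop_bracket_def diffop_mult_tp Omega_act_diff Omega_act_0_tp pcompose_mult
          pcompose_smult pcompose_uminus pcompose_shift reflect power_int_add smult_diff_right algebra_simps)
  next
    case 2
    then show ?thesis using assms
      by (simp add: diffop_bracket_def diffop_mult_tp Omega_act_diff Omega_act_1_tp[simplified] pcompose_mult
          pcompose_smult pcompose_shift power_int_add smult_diff_right algebra_simps)
  qed
qed

lemma lie_module_Omega: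
  assumes "lam \<noteq> 0" "\<epsilon> \<in> {0, 1}"
  shows "lie_module diffop_scale diffop_bracket smult (Omega_act lam \<epsilon>)"
proof -
  have br: "diffop_bracket (a + b) c = diffop_bracket a c + diffop_bracket b c"
    "diffop_bracket a (b + c) = diffop_bracket a b + diffop_bracket a c"
    "diffop_bracket (diffop_scale r a) c = diffop_scale r (diffop_bracket a c)"
    "diffop_bracket a (diffop_scale r c) = diffop_scale r (diffop_bracket a c)" for a b c r
    by (simp_all add: diffop_bracket_def diffop_mult_bilinear dv.scale_right_diff_distrib)
  show ?thesis
  proof (intro lie_module.intro lie_module_axioms.intro lie_algebra_diffop vector_space_smult)
    fix a b f
    show "Vector_Spaces.linear smult smult (\<lambda>f. Omega_act lam \<epsilon> a f)"
      and "Vector_Spaces.linear diffop_scale smult (\<lambda>a. Omega_act lam \<epsilon> a f)"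
      by (auto intro!: linearI vector_space_diffop vector_space_smult simp: Omega_act_left Omega_act_right)
    show "Omega_act lam \<epsilon> (diffop_bracket a b) f =
        Omega_act lam \<epsilon> a (Omega_act lam \<epsilon> b f) - Omega_act lam \<epsilon> b (Omega_act lam \<epsilon> a f)"
    proof (induction a rule: diffop_induct)
      case (tD m n)
      show ?case
      proof (induction b rule: diffop_induct)
        case (tD m' n')
        show ?case
          using Omega_act_bracket_tD[OF assms] by (simp flip: tp_monom)
      qed (simp_all add: br Omega_act_left Omega_act_right smult_diff_right)
    qed (simp_all add: br Omega_act_left Omega_act_right smult_diff_right)
  qed
qed

end

theory Submission
  imports Defs
begin

text \<open>
  A module that is free of rank one over \<open>\<complex>[D]\<close> may be taken to be \<open>\<complex>[x]\<close> with \<open>D\<close> acting as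
  multiplication by \<open>x\<close>. Since \<open>[D, t\<^sup>m p(D)] = m t\<^sup>m p(D)\<close>, the element \<open>t\<^sup>m p(D)\<close> then acts by
  \<open>f(x) \<mapsto> g\<^sub>m(p)(x) f(x - m)\<close>, where \<open>g\<^sub>m(p) = t\<^sup>m p(D) \<cdot> 1\<close>, and the whole action is a family of
  linear maps \<open>g\<^sub>m\<close> on \<open>\<complex>[x]\<close> subject to the functional equations expressed by \<open>g_bracket\<close>.

  The decisive element is \<open>D\<^sup>2\<close>, of weight \<open>0\<close>. It satisfies \<open>[D\<^sup>2, t\<^sup>m p(D)] = t\<^sup>m (2 m D + m\<^sup>2) p(D)\<close>,
  while on the module it acts by multiplication with a polynomial \<open>c(x)\<close>.
  Comparing the two shows for \<open>m \<noteq> 0\<close> that replacing \<open>p\<close> by \<open>D p\<close> multiplies \<open>g\<^sub>m(p)\<close> by a fixed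
  function \<open>e\<^sub>m\<close> depending only on \<open>c\<close>. Hence \<open>g\<^sub>m(p) = g\<^sub>m(1) p(e\<^sub>m)\<close>
  (\<open>g_nonzero_weight\<close>), which turns every bracket relation into an identity between a few polynomials.

  The brackets of weight \<open>m\<close> with weight \<open>-m\<close> determine these polynomials. Such a bracket says that
  the image of a known element of \<open>\<complex>[D]\<close> is a difference \<open>H(x - m) - H(x)\<close>
  (\<open>g_bracket_opposite\<close>), and a polynomial with a nonzero period is constant.

  \<^item> \<open>[t\<^sup>m, t\<^sup>-\<^sup>m] = 0\<close> makes the product \<open>g\<^sub>-\<^sub>m(1)(x) g\<^sub>m(1)(x + m)\<close> constant.
  \<^item> \<open>[t D, t\<^sup>-\<^sup>1 D] = -2 D\<close> makes \<open>E (E + 1)\<close> a quadratic polynomial, for \<open>E(x) = e\<^sub>1(x + 1)\<close>.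
    So \<open>E\<close> is linear, and therefore \<open>c(x) = u x\<^sup>2 + \<eta>\<close>.
  \<^item> \<open>[t\<^sup>m D, t\<^sup>-\<^sup>m D\<^sup>2]\<close> gives \<open>12 u \<eta> = m\<^sup>2 (u\<^sup>2 - 1)\<close> for all \<open>m \<noteq> 0\<close>, so \<open>u = \<plusminus>1\<close>. This is
    where the two families \<open>\<epsilon> = 1\<close> and \<open>\<epsilon> = 0\<close> separate.

  With \<open>\<gamma> = u\<close>, the bracket \<open>[t\<^sup>m, t\<^sup>n D] = - m t\<^sup>m\<^sup>+\<^sup>n\<close> makes \<open>m \<mapsto> \<gamma> g\<^sub>m(1)\<close> multiplicative, hence equal
  to \<open>\<lambda>\<^sup>m\<close>. Finally every element of \<open>\<complex>[D]\<close> is a bracket \<open>[t, t\<^sup>-\<^sup>1 q(D)] = q(D) - q(D + 1)\<close>, since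
  the forward difference is surjective on polynomials, and so weight \<open>0\<close> is determined by the
  nonzero weights (\<open>g_formula\<close>).
\<close>

section \<open>Polynomials and translations\<close>

lemma poly_ext: "p = q" if "\<And>x. poly p x = poly q x" for p q :: "complex poly"
  using that by (simp add: poly_eq_poly_eq_iff[symmetric] ext)

lemma poly_shift: "poly (pcompose p [:a, 1:]) x = poly p (x + a)" for a :: "'a::comm_ring_1"
  by (simp add: poly_pcompose add.commute)

text \<open>A periodic \<open>f\<close> takes the value \<open>f(0)\<close> at every multiple of the period, hence infinitely often.\<close>

lemma periodic_poly_constant:
  fixes f :: "complex poly"
  assumes "a \<noteq> 0" and per: "\<And>x. poly f (x - a) = poly f x"
  shows "poly f x = poly f 0"
proof -
  let ?h = "f - [:poly f 0:]"
  have root: "poly ?h (- of_nat n * a) = 0" for n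
  proof (induction n)
    case (Suc n)
    have "- of_nat (Suc n) * a = - of_nat n * a - a" by (simp add: algebra_simps)
    then show ?case using Suc.IH per[of "- of_nat n * a"] by simp
  qed simp
  have "inj (\<lambda>n::nat. - of_nat n * a)"
    using \<open>a \<noteq> 0\<close> by (auto simp: inj_def)
  then have "infinite (range (\<lambda>n::nat. - of_nat n * a))"
    by (rule range_inj_infinite)
  moreover have "range (\<lambda>n::nat. - of_nat n * a) \<subseteq> {x. poly ?h x = 0}"
    using root by blast
  ultimately have "infinite {x. poly ?h x = 0}"
    using finite_subset by blast
  then have "?h = 0" using poly_roots_finite by blast
  then have "poly ?h x = poly 0 x" by (rule arg_cong)
  then show ?thesis by simp
qed

text \<open>
  The difference of \<open>x\<^sup>n\<^sup>+\<^sup>1\<close> is \<open>(n + 1) x\<^sup>n\<close> plus lower powers, and these are already differences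
  of some \<open>Q\<^sub>i\<close> by induction.
\<close>

lemma forward_difference_surjective:
  fixes r :: "complex poly"
  shows "\<exists>q. pcompose q [:1, 1:] - q = r"
proof (induction r rule: poly_linear_induct)
  case (add a b)
  then obtain p q where pq: "pcompose p [:1, 1:] - p = a" "pcompose q [:1, 1:] - q = b" by blast
  have "pcompose (p + q) [:1, 1:] - (p + q) = (pcompose p [:1, 1:] - p) + (pcompose q [:1, 1:] - q)"
    by (simp add: pcompose_add)
  then show ?case unfolding pq by (rule exI)
next
  case (smult c a)
  then obtain p where p: "pcompose p [:1, 1:] - p = a" by blast
  have "pcompose (smult c p) [:1, 1:] - smult c p = smult c (pcompose p [:1, 1:] - p)"
    by (simp add: pcompose_smult smult_diff_right)
  then show ?case unfolding p by (rule exI)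
next
  case (monom n)
  show ?case
  proof (induction n rule: less_induct)
    case (less n)
    then have "\<forall>i\<in>{..<n}. \<exists>q. pcompose q [:1, 1:] - q = monom (1 :: complex) i" by blast
    from bchoice[OF this] obtain Q where "\<forall>i\<in>{..<n}. pcompose (Q i) [:1, 1:] - Q i = monom (1 :: complex) i" ..
    then have Q: "pcompose (Q i) [:1, 1:] - Q i = monom 1 i" if "i < n" for i
      using that by blast
    define W where "W = monom 1 (Suc n) - (\<Sum>i<n. smult (of_nat (Suc n choose i)) (Q i))"
    have W: "poly W x = x ^ Suc n - (\<Sum>i<n. of_nat (Suc n choose i) * poly (Q i) x)" for x
      by (simp add: W_def poly_sum poly_monom del: binomial_Suc_Suc power_Suc)
    have Q': "poly (Q i) (x + 1) = poly (Q i) x + x ^ i" if "i < n" for i x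
      using arg_cong[OF Q[OF that], of "\<lambda>p. poly p x"]
      by (simp add: poly_shift poly_monom algebra_simps)
    have "pcompose W [:1, 1:] - W = smult (of_nat (Suc n)) (monom 1 n)"
    proof (rule poly_ext)
      fix x :: complex
      have top: "sum F {..Suc n} = F (Suc n) + F n + sum F {..<n}" for F :: "nat \<Rightarrow> complex"
        by (simp flip: lessThan_Suc_atMost)
      have "(x + 1) ^ Suc n = (\<Sum>i\<le>Suc n. of_nat (Suc n choose i) * x ^ i)"
        by (subst binomial_ring) (simp only: power_one mult_1_right)
      also have "\<dots> = x ^ Suc n + of_nat (Suc n) * x ^ n + (\<Sum>i<n. of_nat (Suc n choose i) * x ^ i)"
        by (simp only: top binomial_Suc_n binomial_n_n of_nat_1 mult_1_left)
      finally have bin: "(x + 1) ^ Suc n = \<dots>" .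
      have "(\<Sum>i<n. of_nat (Suc n choose i) * poly (Q i) (x + 1)) =
          (\<Sum>i<n. of_nat (Suc n choose i) * poly (Q i) x) + (\<Sum>i<n. of_nat (Suc n choose i) * x ^ i)"
        unfolding sum.distrib[symmetric] by (rule sum.cong) (simp_all only: Q' lessThan_iff distrib_left)
      then have "poly W (x + 1) - poly W x = of_nat (Suc n) * x ^ n"
        by (simp only: W bin right_diff_distrib) (simp only: algebra_simps)
      then show "poly (pcompose W [:1, 1:] - W) x = poly (smult (of_nat (Suc n)) (monom 1 n)) x"
        by (simp only: poly_diff poly_shift poly_smult poly_monom mult_1_left)
    qed
    then have "pcompose (smult (1 / of_nat (Suc n)) W) [:1, 1:] - smult (1 / of_nat (Suc n)) W = monom 1 n"
      by (simp add: pcompose_smult flip: smult_diff_right del: of_nat_Suc)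
    then show ?case by blast
  qed
qed

text \<open>
  The factors \<open>E\<close> and \<open>E + 1\<close> have the same degree, so both are linear. Comparing coefficients, the
  two roots of the product average to \<open>-1/2\<close>, which fixes the constant term of \<open>E\<close>.
\<close>

lemma linear_of_quadratic_product:
  fixes E :: "complex poly"
  assumes eq: "\<And>x. A * poly E x * (poly E x + 1) = x\<^sup>2 + x + k"
  obtains u where "A * u\<^sup>2 = 1" "\<And>x. poly E x = u * x + (u - 1) / 2"
proof -
  have "A \<noteq> 0"
  proof
    assume "A = 0"
    then show False using eq[of 0] eq[of 1] by simp
  qed
  have pe: "smult A (E * (E + 1)) = [:k, 1, 1:]"
    by (rule poly_ext) (use eq in \<open>simp add: algebra_simps power2_eq_square\<close>)
  have nz: "E \<noteq> 0" "E + 1 \<noteq> 0" using pe by auto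
  have "degree (E * (E + 1)) = 2"
    using arg_cong[OF pe, of degree] \<open>A \<noteq> 0\<close> by simp
  then have "degree E + degree (E + 1) = 2"
    using nz by (simp add: degree_mult_eq)
  moreover have "degree (E + 1) = degree E"
  proof (cases "degree E = 0")
    case True
    then show ?thesis using degree_add_le[of E 0 1] by simp
  qed (simp add: degree_add_eq_left)
  ultimately have "degree E = 1" by simp
  then obtain v u where E: "E = [:v, u:]"
    by (metis degree1_coeffs)
  have at0: "A * v * (v + 1) = k" using eq[of 0] by (simp add: E)
  have at1: "A * (v + u) * (v + u + 1) = 2 + k" using eq[of 1] by (simp add: E)
  have atm1: "A * (v - u) * (v - u + 1) = k" using eq[of "-1"] by (simp add: E)
  have "2 * (A * u\<^sup>2) = A * (v + u) * (v + u + 1) + A * (v - u) * (v - u + 1) - 2 * (A * v * (v + 1))"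
    by (simp add: algebra_simps power2_eq_square)
  then have "2 * (A * u\<^sup>2) = 2" unfolding at0 at1 atm1 by simp
  then have "A * u\<^sup>2 = 1" by simp
  moreover have "2 * (A * u * (2 * v + 1)) = A * (v + u) * (v + u + 1) - A * (v - u) * (v - u + 1)"
    by (simp add: algebra_simps)
  then have "2 * (A * u * (2 * v + 1)) = 2" unfolding at1 atm1 by simp
  then have "A * u * (2 * v + 1) = 1" by simp
  ultimately have "A * u * (2 * v + 1) = A * u * u"
    by (simp add: power2_eq_square mult.assoc)
  moreover have "A * u \<noteq> 0" using \<open>A * u\<^sup>2 = 1\<close> by auto
  ultimately have "2 * v + 1 = u" using mult_left_cancel by blast
  then have "v = (u - 1) / 2" by auto
  then show ?thesis
    using that \<open>A * u\<^sup>2 = 1\<close> E by (simp add: mult.commute)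
qed

section \<open>\<open>\<D>\<close>-module structures on \<open>\<complex>[x]\<close> in which \<open>D\<close> acts as \<open>x\<close>\<close>

locale polynomial_diffop_module =
  lie_module diffop_scale diffop_bracket smult L for L :: "diffop \<Rightarrow> complex poly \<Rightarrow> complex poly" +
  assumes D_acts: "L (tD 0 1) f = [:0, 1:] * f"
begin

lemma L_add: "L (a + b) f = L a f + L b f"
  and L_scale: "L (diffop_scale s a) f = smult s (L a f)"
  and L_add_right: "L a (f + h) = L a f + L a h"
  and L_smult: "L a (smult s f) = smult s (L a f)"
proof -
  interpret l: Vector_Spaces.linear diffop_scale smult "\<lambda>a. L a f" by (rule linear_act_left)
  interpret r: Vector_Spaces.linear smult smult "L a" by (rule linear_act)
  show "L (a + b) f = L a f + L b f" by (rule l.add)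
  show "L (diffop_scale s a) f = smult s (L a f)" by (rule l.scale)
  show "L a (f + h) = L a f + L a h" by (rule r.add)
  show "L a (smult s f) = smult s (L a f)" by (rule r.scale)
qed

lemma bracket_tp:
  "diffop_bracket (tp m p) (tp n q) =
     tp (m + n) (pcompose p [:of_int n, 1:] * q - pcompose q [:of_int m, 1:] * p)"
proof -
  have "tp k (a - b) = tp k a - tp k b" for k a b
    using tp_add[of k "a - b" b] by simp
  then show ?thesis
    by (simp add: diffop_bracket_def diffop_mult_tp add.commute)
qed

text \<open>
  Values at points are used instead of polynomials, so that a translation becomes a plain change of
  the argument.
\<close>

definition g :: "int \<Rightarrow> complex poly \<Rightarrow> complex \<Rightarrow> complex" where
  "g m p x = poly (L (tp m p) 1) x"

text \<open>
  The relation \<open>[D, t\<^sup>m p(D)] = m t\<^sup>m p(D)\<close> moves \<open>x\<close> past \<open>t\<^sup>m p(D)\<close> at the cost of replacing it by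
  \<open>x - m\<close>, so the action on \<open>1\<close> determines the action on every \<open>f\<close>.
\<close>

lemma L_tp: "L (tp m p) f = L (tp m p) 1 * pcompose f [:- of_int m, 1:]"
proof (induction f)
  case 0
  then show ?case using L_smult[of "tp m p" 0 0] by simp
next
  case (pCons s f)
  have D: "tD 0 1 = tp 0 [:0, 1:]"
    using tp_monom[of 0 1] by (simp add: monom_altdef)
  have "diffop_bracket (tD 0 1) (tp m p) = diffop_scale (of_int m) (tp m p)"
    by (simp only: D bracket_tp) (simp add: pcompose_pCons algebra_simps flip: tp_smult)
  then have "smult (of_int m) (L (tp m p) f) = [:0, 1:] * L (tp m p) f - L (tp m p) ([:0, 1:] * f)"
    using act_bracket[of "tD 0 1" "tp m p" f] by (simp only: L_scale D_acts)
  then have x: "L (tp m p) ([:0, 1:] * f) = [:- of_int m, 1:] * L (tp m p) f"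
    by (simp add: algebra_simps)
  have "pCons s f = smult s 1 + [:0, 1:] * f" by simp
  then have "L (tp m p) (pCons s f) = smult s (L (tp m p) 1) + [:- of_int m, 1:] * L (tp m p) f"
    by (simp only: L_add_right L_smult x)
  then show ?case
    by (subst (asm) pCons.IH) (simp add: pcompose_pCons algebra_simps)
qed

lemma g_add: "g m (p + q) x = g m p x + g m q x"
  and g_smult: "g m (smult s p) x = s * g m p x"
  by (simp_all add: g_def tp_add tp_smult L_add L_scale)

lemma g_bracket:
  "g (m + n) (pcompose p [:of_int n, 1:] * q - pcompose q [:of_int m, 1:] * p) x =
    g m p x * g n q (x - of_int m) - g n q x * g m p (x - of_int n)"
  unfolding g_def bracket_tp[symmetric] act_bracket
  by (subst L_tp, subst (3) L_tp) (simp add: poly_shift)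

lemma g_X: "g 0 [:0, 1:] x = x"
  using D_acts[of 1] tp_monom[of 0 1] by (simp add: g_def monom_altdef)

text \<open>By \<open>L_tp\<close> the element \<open>D\<^sup>2\<close>, having weight \<open>0\<close>, acts as multiplication by \<open>c\<close>.\<close>

definition c :: "complex \<Rightarrow> complex" where
  "c = g 0 ([:0, 1:]\<^sup>2)"

text \<open>
  The value at which \<open>p\<close> is evaluated in weight \<open>m \<noteq> 0\<close>. In \<open>\<Omega>(\<lambda>, 1)\<close> it is \<open>x - m\<close>, in
  \<open>\<Omega>(\<lambda>, 0)\<close> it is \<open>-x\<close>.
\<close>

definition e :: "int \<Rightarrow> complex \<Rightarrow> complex" where
  "e m x = (c x - c (x - of_int m) - (of_int m)\<^sup>2) / (2 * of_int m)"

text \<open>This is the bracket \<open>[t\<^sup>m p(D), D\<^sup>2]\<close> applied to \<open>1\<close>, solved for the term \<open>t\<^sup>m D p(D)\<close>.\<close>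

lemma g_mult_X:
  assumes "m \<noteq> 0"
  shows "g m ([:0, 1:] * p) x = e m x * g m p x"
proof -
  let ?m = "of_int m :: complex"
  have "p * [:0, 1:]\<^sup>2 - pcompose ([:0, 1:]\<^sup>2) [:?m, 1:] * p =
      smult (- 2 * ?m) ([:0, 1:] * p) + smult (- ?m\<^sup>2) p"
    by (rule poly_ext) (simp add: poly_pcompose algebra_simps power2_eq_square)
  then have "- 2 * ?m * g m ([:0, 1:] * p) x - ?m\<^sup>2 * g m p x = g m p x * c (x - ?m) - c x * g m p x"
    using g_bracket[of m 0 p "[:0, 1:]\<^sup>2" x]
    by (simp only: g_add g_smult c_def of_int_0 add_0_right pcompose_idR) simp
  then have "2 * ?m * g m ([:0, 1:] * p) x = (c x - c (x - ?m) - ?m\<^sup>2) * g m p x"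
    by (simp add: algebra_simps)
  then show ?thesis using assms by (simp add: e_def field_simps)
qed

lemma g_nonzero_weight:
  assumes "m \<noteq> 0"
  shows "g m p x = g m 1 x * poly p (e m x)"
proof (induction p)
  case 0
  then show ?case using g_smult[of m 0 1 x] by simp
next
  case (pCons s p)
  have "pCons s p = smult s 1 + [:0, 1:] * p" by simp
  then have "g m (pCons s p) x = s * g m 1 x + e m x * g m p x"
    by (simp only: g_add g_smult g_mult_X[OF assms])
  then show ?case by (simp add: pCons.IH algebra_simps)
qed

text \<open>
  Because of this, the arguments occurring in a bracket of opposite weights are \<open>E\<close> and \<open>E + m\<close> for
  a single polynomial \<open>E\<close>.
\<close>

lemma e_opposite: "e (- m) x = e m (x + of_int m) + of_int m"  if "m \<noteq> 0"
  using that by (simp add: e_def field_simps power2_eq_square)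

text \<open>The multiplier by which the composition \<open>t\<^sup>-\<^sup>m t\<^sup>m\<close> in \<open>U(\<D>)\<close> acts, as \<open>t\<^sup>-\<^sup>m\<close> translates by \<open>m\<close>.\<close>

definition A :: "int \<Rightarrow> complex \<Rightarrow> complex" where
  "A m x = g (- m) 1 x * g m 1 (x + of_int m)"

text \<open>
  Opposite weights cancel the translations, so that the two orders of composition give the same
  function \<open>H\<close> at points that differ by \<open>m\<close>.
\<close>

lemma g_bracket_opposite:
  fixes m :: int and p q :: "complex poly"
  defines "H \<equiv> \<lambda>x. A m x * poly p (e m (x + of_int m)) * poly q (e m (x + of_int m) + of_int m)"
  assumes "m \<noteq> 0"
  shows "g 0 (pcompose p [:- of_int m, 1:] * q - pcompose q [:of_int m, 1:] * p) x =
    H (x - of_int m) - H x"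
  using g_bracket[of m "- m" p q x] assms(2)
  by (simp add: H_def A_def g_nonzero_weight[of m p] g_nonzero_weight[of "- m" q] e_opposite)

lemma A_constant:
  assumes "m \<noteq> 0"
  shows "A m x = A m 0"
proof -
  let ?P = "L (tp (- m) 1) 1 * pcompose (L (tp m 1) 1) [:of_int m, 1:]"
  have P: "poly ?P y = A m y" for y
    by (simp add: A_def g_def poly_shift)
  have "A m (y - of_int m) = A m y" for y
    using g_bracket_opposite[OF assms, of 1 1 y] g_smult[of 0 0 1 y] by (simp add: pcompose_1)
  then show ?thesis
    using periodic_poly_constant[of "of_int m" ?P x] assms by (simp only: P) simp
qed

text \<open>
  With \<open>E(x) = e\<^sub>1(x + 1)\<close>, the bracket \<open>[t D, t\<^sup>-\<^sup>1 D] = -2 D\<close> says that \<open>A E (E + 1)\<close> has the same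
  differences as \<open>x\<^sup>2 + x\<close>. Hence \<open>E\<close> is linear, and \<open>c\<close>, whose differences it determines, is
  quadratic.
\<close>

lemma c_quadratic:
  obtains u \<eta> where "u \<noteq> 0" "A 1 0 * u\<^sup>2 = 1" "\<And>x. c x = u * x\<^sup>2 + \<eta>"
proof -
  define C where "C = L (tp 0 ([:0, 1:]\<^sup>2)) 1"
  have C: "poly C x = c x" for x by (simp add: C_def c_def g_def)
  define E where "E = smult (1/2) (pcompose C [:1, 1:] - C - 1)"
  have E: "poly E x = e 1 (x + 1)" for x
    by (simp add: E_def e_def poly_shift C)
  have diff: "- 2 * x = A 1 0 * poly E (x - 1) * (poly E (x - 1) + 1) - A 1 0 * poly E x * (poly E x + 1)" for x
  proof -
    have X: "pcompose [:0, 1:] [:- 1, 1:] * [:0, 1:] - pcompose [:0, 1:] [:1, 1:] * [:0, 1:] =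
        smult (- 2) [:0, 1::complex:]"
      by (simp add: pcompose_pCons)
    show ?thesis
      using g_bracket_opposite[of 1 "[:0, 1:]" "[:0, 1:]" x]
      unfolding A_constant[of 1 x, simplified] A_constant[of 1 "x - 1", simplified] of_int_1 X g_smult g_X
      by (simp add: E A_constant[of 1 x] A_constant[of 1 "x - 1"])
  qed
  define k where "k = A 1 0 * poly E 0 * (poly E 0 + 1)"
  have "poly (smult (A 1 0) (E * (E + 1)) - [:0, 1, 1:]) x = k" for x
    using periodic_poly_constant[of 1 "smult (A 1 0) (E * (E + 1)) - [:0, 1, 1:]" x] diff
    by (simp add: k_def algebra_simps)
  then have "A 1 0 * poly E x * (poly E x + 1) = x\<^sup>2 + x + k" for x
    by (simp add: algebra_simps power2_eq_square)
  then obtain u where u: "A 1 0 * u\<^sup>2 = 1" "\<And>x. poly E x = u * x + (u - 1) / 2"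
    by (rule linear_of_quadratic_product) blast
  have step: "c x - c (x - 1) = u * (2 * x - 1)" for x
  proof -
    have "c x - c (x - 1) = 2 * poly E (x - 1) + 1"
      by (simp add: E e_def diff_divide_distrib)
    also have "\<dots> = u * (2 * x - 1)"
      by (simp add: u field_simps)
    finally show ?thesis .
  qed
  have "poly (C - [:0, 0, u:]) (x - 1) = poly (C - [:0, 0, u:]) x" for x
    using step[of x] by (simp add: C algebra_simps)
  then have const: "poly (C - [:0, 0, u:]) x = poly (C - [:0, 0, u:]) 0" for x
    by (rule periodic_poly_constant[OF one_neq_zero])
  have "c x = u * x\<^sup>2 + c 0" for x
    using const[of x] by (simp add: C algebra_simps power2_eq_square)
  moreover have "u \<noteq> 0" using u(1) by auto
  ultimately show ?thesis using u(1) that by blast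
qed

text \<open>
  The relation \<open>12 u \<eta> = m\<^sup>2 (u\<^sup>2 - 1)\<close> has a left-hand side independent of \<open>m\<close>, so \<open>u\<^sup>2 = 1\<close>. It comes
  from the constant term of the bracket \<open>[t\<^sup>m D, t\<^sup>-\<^sup>m D\<^sup>2] = -3 m D\<^sup>2 - m\<^sup>2 D\<close>. The bracket
  \<open>[t\<^sup>m, t\<^sup>-\<^sup>m D] = -m\<close> shows beforehand that \<open>A\<^sub>m\<close> is the same for all \<open>m\<close>.
\<close>

lemma leading_coefficient_sign:
  obtains \<gamma> where "\<gamma> = 1 \<or> \<gamma> = - 1"
    "\<And>m x. m \<noteq> 0 \<Longrightarrow> e m x = \<gamma> * x - (\<gamma> + 1) * of_int m / 2"
    "\<And>m. m \<noteq> 0 \<Longrightarrow> A m 0 = 1" "\<And>x. g 0 1 x = \<gamma>"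
proof -
  obtain u \<eta> where u: "u \<noteq> 0" "A 1 0 * u\<^sup>2 = 1" and c: "\<And>x. c x = u * x\<^sup>2 + \<eta>"
    by (rule c_quadratic) blast
  have e: "e m x = u * x - (u + 1) * of_int m / 2" if "m \<noteq> 0" for m x
    using that by (simp add: e_def c field_simps power2_eq_square)
  have a0: "g 0 1 x = u * A m 0" if "m \<noteq> 0" for m x
  proof -
    have P: "pcompose 1 [:- of_int m, 1:] * [:0, 1:] - pcompose [:0, 1:] [:of_int m, 1:] * 1 =
        smult (- of_int m) (1 :: complex poly)"
      by (simp add: pcompose_pCons one_pCons)
    show ?thesis
      using g_bracket_opposite[OF that, of 1 "[:0, 1:]" x] that
      unfolding P g_smult A_constant[OF that, of x] A_constant[OF that, of "x - of_int m"]
      by (simp add: e algebra_simps)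
  qed
  have Am: "A m 0 = A 1 0" if "m \<noteq> 0" for m
    using a0[OF that] a0[of 1] u by simp
  have eta: "12 * u * \<eta> = of_int m ^ 2 * (u\<^sup>2 - 1)" if "m \<noteq> 0" for m
  proof -
    let ?m = "of_int m :: complex"
    have P: "pcompose [:0, 1:] [:- ?m, 1:] * [:0, 1:]\<^sup>2 - pcompose ([:0, 1:]\<^sup>2) [:?m, 1:] * [:0, 1:] =
        smult (- 3 * ?m) ([:0, 1:]\<^sup>2) + smult (- ?m\<^sup>2) [:0, 1:]"
      by (rule poly_ext) (simp add: poly_pcompose algebra_simps power2_eq_square)
    define v where "v = A 1 0"
    have v: "v * u\<^sup>2 = 1" using u by (simp add: v_def)
    \<comment> \<open>The bracket evaluated at \<open>x = 0\<close>; the factor \<open>16\<close> is what clearing denominators leaves.\<close>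
    have "16 * (12 * ?m * \<eta>) = 16 * (?m * (v * ?m^2 * u * (u\<^sup>2 - 1)))"
      using g_bracket_opposite[OF that, of "[:0, 1:]" "[:0, 1:]\<^sup>2" 0] v
      unfolding P g_add g_smult g_X A_constant[OF that, of "0 - of_int m"] Am[OF that] c_def[symmetric] v_def[symmetric] c
      by (simp add: e[OF that] field_simps power2_eq_square)
    then have "12 * \<eta> = v * ?m^2 * u * (u\<^sup>2 - 1)"
      using that by simp
    then have "12 * u * \<eta> = (v * u\<^sup>2) * ?m^2 * (u\<^sup>2 - 1)"
      by (simp add: power2_eq_square)
    then show ?thesis by (simp add: v)
  qed
  have "u\<^sup>2 = 1"
    using eta[of 1] eta[of 2] by simp
  then have u': "u = 1 \<or> u = - 1" by (simp add: power2_eq_1_iff)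
  moreover have "A m 0 = 1" if "m \<noteq> 0" for m
    using Am[OF that] u \<open>u\<^sup>2 = 1\<close> by simp
  ultimately show ?thesis
    using that[of u] e a0[of 1] by simp
qed

text \<open>
  The argument \<open>\<gamma> x - (\<gamma> + 1) m / 2\<close> is \<open>x - m\<close> for \<open>\<gamma> = 1\<close> and \<open>-x\<close> for \<open>\<gamma> = -1\<close>; in this common
  form the formula covers weight \<open>0\<close> as well.
\<close>

lemma g_formula:
  obtains lam \<gamma> where "lam \<noteq> 0" "\<gamma> = 1 \<or> \<gamma> = - 1"
    "\<And>m p x. g m p x = \<gamma> * lam powi m * poly p (\<gamma> * x - (\<gamma> + 1) * of_int m / 2)"
proof -
  obtain \<gamma> where \<gamma>: "\<gamma> = 1 \<or> \<gamma> = - 1"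
    and e: "\<And>m x. m \<noteq> 0 \<Longrightarrow> e m x = \<gamma> * x - (\<gamma> + 1) * of_int m / 2"
    and A: "\<And>m. m \<noteq> 0 \<Longrightarrow> A m 0 = 1" and g0: "\<And>x. g 0 1 x = \<gamma>"
    using leading_coefficient_sign by metis
  have \<gamma>2: "\<gamma> * \<gamma> = 1" using \<gamma> by auto
  have const: "g m 1 x = g m 1 0" for m x
  proof (cases "m = 0")
    case False
    \<comment> \<open>Two polynomials whose product is \<open>1\<close> are constants.\<close>
    let ?p = "L (tp (- m) 1) 1" and ?q = "pcompose (L (tp m 1) 1) [:of_int m, 1:]"
    have "?p * ?q = 1"
    proof (rule poly_ext)
      fix y
      show "poly (?p * ?q) y = poly 1 y"
        using A_constant[OF False, of y] A[OF False] by (simp add: A_def g_def poly_shift)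
    qed
    then have "is_unit ?q" by (metis dvd_triv_right)
    then obtain b where "?q = [:b:]" by (metis is_unit_poly_iff)
    then have "poly ?q y = b" for y by simp
    then have "g m 1 (y + of_int m) = b" for y by (simp add: g_def poly_shift)
    from this[of "x - of_int m"] this[of "- of_int m"] show ?thesis by simp
  qed (simp add: g0)
  define s where "s m = \<gamma> * g m 1 0" for m
  have s: "g m 1 x = \<gamma> * s m" for m x
    using const[of m x] \<gamma>2 by (simp add: s_def mult.assoc[symmetric])
  have s0: "s 0 = 1" by (simp add: s_def g0 \<gamma>2)
  \<comment> \<open>From \<open>[t\<^sup>m, t\<^sup>n D] = - m t\<^sup>m\<^sup>+\<^sup>n\<close>, using that \<open>e\<^sub>n\<close> has slope \<open>\<gamma>\<close>.\<close>
  have s_add: "s (m + n) = s m * s n" for m n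
  proof (cases "m = 0 \<or> n = 0")
    case False
    then have mn: "m \<noteq> 0" "n \<noteq> 0" by auto
    have P: "pcompose 1 [:of_int n, 1:] * [:0, 1:] - pcompose [:0, 1:] [:of_int m, 1:] * 1 =
        smult (- of_int m) (1 :: complex poly)"
      by (simp add: pcompose_pCons one_pCons)
    have "- of_int m * (\<gamma> * s (m + n)) = \<gamma> * s m * (\<gamma> * s n) * (- \<gamma> * of_int m)"
      using g_bracket[of m n 1 "[:0, 1:]" 0]
      unfolding P g_smult g_nonzero_weight[OF mn(2), of "[:0, 1:]"] s e[OF mn(2)]
      by (simp add: algebra_simps)
    then have "\<gamma> * s (m + n) = \<gamma> * (\<gamma> * \<gamma>) * (s m * s n)"
      using mn by (simp add: ac_simps)
    then show ?thesis using \<gamma>2 \<gamma> by auto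
  qed (auto simp: s0)
  have s1: "s 1 \<noteq> 0" using s_add[of 1 "- 1"] s0 by auto
  have s_pow: "s m = s 1 powi m" for m
  proof (induction m rule: int_induct[of _ 0])
    case (step1 i)
    then show ?case using s_add[of i 1] s1 by (simp add: power_int_add)
  next
    case (step2 i)
    then show ?case using s_add[of "i - 1" 1] s1 by (simp add: power_int_diff field_simps)
  qed (simp add: s0)
  have g_eq: "g m p x = \<gamma> * s m * poly p (\<gamma> * x - (\<gamma> + 1) * of_int m / 2)" for m p x
  proof (cases "m = 0")
    case False
    then show ?thesis by (simp add: g_nonzero_weight[of m p] e s)
  next
    case True
    \<comment> \<open>Then \<open>p(D) = [t, t\<^sup>-\<^sup>1 q(D)]\<close>, and the action in the weights \<open>1\<close> and \<open>-1\<close> is known.\<close>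
    obtain q where q: "pcompose q [:1, 1:] - q = - p"
      using forward_difference_surjective by blast
    have "g 0 p x = poly q (e 1 x + 1) - poly q (e 1 (x + 1) + 1)"
    proof -
      have P: "pcompose 1 [:- of_int 1, 1:] * q - pcompose q [:of_int 1, 1:] * 1 = p"
        using arg_cong[OF q, of uminus] by (simp only: minus_diff_eq minus_minus) (simp add: pcompose_1)
      show ?thesis
        using g_bracket_opposite[of 1 1 q x] A_constant[of 1 x] A_constant[of 1 "x - 1"] A[of 1]
        unfolding P by simp
    qed
    moreover have "poly q (y + 1) - poly q y = - poly p y" for y
      using arg_cong[OF q, of "\<lambda>p. poly p y"] by (simp add: poly_shift)
    from this[of x] this[of "- x"] have "poly q (e 1 x + 1) - poly q (e 1 (x + 1) + 1) = \<gamma> * poly p (\<gamma> * x)"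
      using \<gamma> by (auto simp: e algebra_simps)
    ultimately show ?thesis by (simp add: True s0)
  qed
  show ?thesis
    by (rule that[OF s1 \<gamma>]) (simp only: g_eq s_pow[symmetric])
qed

lemma L_eq_Omega:
  obtains lam \<epsilon> where "lam \<noteq> 0" "\<epsilon> \<in> {0, 1}" "L = Omega_act lam \<epsilon>"
proof -
  obtain lam \<gamma> where lam: "lam \<noteq> 0" and \<gamma>: "\<gamma> = 1 \<or> \<gamma> = - 1"
    and g: "\<And>m p x. g m p x = \<gamma> * lam powi m * poly p (\<gamma> * x - (\<gamma> + 1) * of_int m / 2)"
    using g_formula by metis
  define \<epsilon> :: nat where "\<epsilon> = (if \<gamma> = 1 then 1 else 0)"
  have "L (tp m p) f = Omega_act lam \<epsilon> (tp m p) f" for m p f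
  proof (rule poly_ext)
    fix x
    have "poly (L (tp m p) f) x = g m p x * poly f (x - of_int m)"
      by (subst L_tp) (simp add: g_def poly_shift)
    then show "poly (L (tp m p) f) x = poly (Omega_act lam \<epsilon> (tp m p) f) x"
      using \<gamma> by (auto simp: g \<epsilon>_def Omega_act_0_tp[OF lam] Omega_act_1_tp[OF lam, simplified] poly_shift poly_pcompose)
  qed
  then have "L a f = Omega_act lam \<epsilon> a f" for a f
    by (induction a rule: diffop_induct)
      (simp_all add: L_add L_scale Omega_act_left flip: tp_monom)
  then have "L = Omega_act lam \<epsilon>" by (intro ext)
  then show ?thesis using that[of lam \<epsilon>] lam by (simp add: \<epsilon>_def)
qed

end

section \<open>Transport to \<open>\<complex>[x]\<close>\<close>

lemma lie_module_transport:
  assumes "lie_module scaleA bracket scaleM act" and lin: "Vector_Spaces.linear scaleN scaleM \<phi>"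
    and "bij \<phi>"
  shows "lie_module scaleA bracket scaleN (\<lambda>a v. inv \<phi> (act a (\<phi> v)))"
proof -
  interpret lie_module scaleA bracket scaleM act by fact
  interpret \<phi>: Vector_Spaces.linear scaleN scaleM \<phi> by fact
  have inv: "inv \<phi> (\<phi> v) = v" "\<phi> (inv \<phi> w) = w" for v w
    using \<open>bij \<phi>\<close> by (simp_all add: bij_is_inj bij_is_surj surj_f_inv_f)
  have inv_lin: "inv \<phi> (v + w) = inv \<phi> v + inv \<phi> w" "inv \<phi> (scaleM s v) = scaleN s (inv \<phi> v)" for v w s
    using \<phi>.add[of "inv \<phi> v" "inv \<phi> w"] \<phi>.scale[of s "inv \<phi> v"] by (metis inv)+
  have inv_diff: "inv \<phi> (v - w) = inv \<phi> v - inv \<phi> w" for v w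
    using inv_lin(1)[of "v - w" w] by (simp add: eq_diff_eq)
  have act: "act a (v + w) = act a v + act a w" "act a (scaleM s v) = scaleM s (act a v)"
    "act (a + b) v = act a v + act b v" "act (scaleA s a) v = scaleM s (act a v)" for a b v w s
    using linear_act[of a] linear_act_left[of v]
    by (simp_all add: Vector_Spaces.linear_def module_hom_iff)
  show ?thesis
    by (intro lie_module.intro lie_module_axioms.intro linearI)
      (simp_all add: A.lie_algebra_axioms \<phi>.vs1.vector_space_axioms A.vector_space_axioms
        \<phi>.add \<phi>.scale act inv inv_lin inv_diff act_bracket)
qed

lemma free_rank_one_generator:
  assumes "free_of_rank scale 1"
  obtains w where "bij (\<lambda>p. scale p w)"
proof -
  interpret module scale using assms by (simp add: free_of_rank_def)
  obtain B where B: "card B = 1" "\<not> dependent B" "span B = UNIV"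
    using assms by (auto simp: free_of_rank_def)
  then obtain w where [simp]: "B = {w}" by (metis card_1_singletonE)
  have "inj (\<lambda>p. scale p w)"
  proof (rule injI)
    fix p q assume "scale p w = scale q w"
    then have "scale (p - q) w = 0" by (simp add: scale_left_diff_distrib)
    then show "p = q"
      using B(2) independentD[of B B "\<lambda>_. p - q" w] by simp
  qed
  moreover have "surj (\<lambda>p. scale p w)"
    using B(3) by (simp add: span_singleton)
  ultimately show ?thesis using that by (simp add: bij_def)
qed

theorem theorem3p2:
  fixes scale :: "complex \<Rightarrow> 'm::ab_group_add \<Rightarrow> 'm"
    and act :: "diffop \<Rightarrow> 'm \<Rightarrow> 'm"
  assumes "lie_module diffop_scale diffop_bracket scale act"
    and "free_of_rank (poly_action scale (act (tD 0 1))) 1"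
  shows "\<exists>lam \<epsilon>. lam \<noteq> 0 \<and> \<epsilon> \<in> {0, 1} \<and>
    lie_modules_isomorphic scale act smult (Omega_act lam \<epsilon>)"
proof -
  interpret lie_module diffop_scale diffop_bracket scale act by fact
  let ?T = "act (tD 0 1)"
  interpret P: module "poly_action scale ?T"
    by (rule M.module_poly_action) (rule linear_act)
  obtain w where bij: "bij (\<lambda>p. poly_action scale ?T p w)"
    using free_rank_one_generator[OF assms(2)] .
  define \<phi> where "\<phi> = (\<lambda>p. poly_action scale ?T p w)"
  have bij: "bij \<phi>" unfolding \<phi>_def by (rule bij)
  have lin: "Vector_Spaces.linear smult scale \<phi>"
    by (rule linearI[OF vector_space_smult M.vector_space_axioms])
      (simp_all add: \<phi>_def M.poly_action_add M.poly_action_smult)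
  have inv: "inv \<phi> (\<phi> p) = p" "\<phi> (inv \<phi> v) = v" for p v
    using bij by (simp_all add: bij_is_inj bij_is_surj surj_f_inv_f)
  define L where "L = (\<lambda>a f. inv \<phi> (act a (\<phi> f)))"
  have mod: "lie_module diffop_scale diffop_bracket smult L"
    unfolding L_def by (rule lie_module_transport[OF assms(1) lin bij])
  have X: "poly_action scale ?T [:0, 1:] v = ?T v" for v
    by (simp add: poly_action_def)
  have "?T (\<phi> f) = \<phi> ([:0, 1:] * f)" for f
    by (simp only: \<phi>_def P.scale_scale[symmetric] X)
  then have "L (tD 0 1) f = [:0, 1:] * f" for f
    by (simp only: L_def inv)
  then interpret L: polynomial_diffop_module L
    by (intro polynomial_diffop_module.intro mod polynomial_diffop_module_axioms.intro)
  obtain lam \<epsilon> where *: "lam \<noteq> 0" "\<epsilon> \<in> {0, 1}" "L = Omega_act lam \<epsilon>"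
    by (rule L.L_eq_Omega) blast
  have "Vector_Spaces.linear scale smult (inv \<phi>)"
  proof (rule linearI[OF M.vector_space_axioms vector_space_smult])
    interpret \<phi>: Vector_Spaces.linear smult scale \<phi> by fact
    show "inv \<phi> (a + b) = inv \<phi> a + inv \<phi> b" for a b
      using \<phi>.add[of "inv \<phi> a" "inv \<phi> b"] by (metis inv)
    show "inv \<phi> (scale s a) = smult s (inv \<phi> a)" for s a
      using \<phi>.scale[of s "inv \<phi> a"] by (metis inv)
  qed
  moreover have "inv \<phi> (act a v) = Omega_act lam \<epsilon> a (inv \<phi> v)" for a v
    using fun_cong[OF fun_cong[OF *(3)], of a "inv \<phi> v"] by (simp add: L_def inv)
  ultimately have "lie_modules_isomorphic scale act smult (Omega_act lam \<epsilon>)"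
    unfolding lie_modules_isomorphic_def using bij_imp_bij_inv[OF bij] by blast
  with * show ?thesis by blast
qed

end
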